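(* Let $d \ge 1$ and $S \subseteq \{0,1\}^d$. Consider the flow network consisting of the directed $d$-dimensional hypercube in which every hypercube edge has capacity $1$, together with a source supernode with an infinite-capacity edge to each vertex of $S$ and a sink supernode with an infinite-capacity edge from each vertex of $\overline{S} = \{0,1\}^d \setminus S$. Then the maximum flow from the source supernode to the sink supernode is at least $\mathrm{vol}^+(S)$, the directed volume of $S$.
   Context: The directed $d$-dimensional hypercube has vertex set $\{0,1\}^d$ and a directed edge $(x,y)$ whenever $x$ and $y$ differ in exactly one coordinate and $y$ has one more $1$ than $x$. Write $x \prec y$ if $x \ne y$ and $x_i \le y_i$ for all $i$. A matched pair $(S',T';\phi)$ consists of sets $S',T' \subseteq \{0,1\}^d$ and a bijection $\phi: S' \to T'$ with $s \prec \phi(s)$ for all $s \in S'$. The directed volume of $S$ is $\mathrm{vol}^+(S) = \max\{|S'| : S' \subseteq S,\ T' \subseteq \overline{S},\ \exists \phi \text{ such that } (S',T';\phi) \text{ is a matched pair}\}$. *)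

theory Defs
  imports "HOL-Library.FuncSet" "HOL-Library.Extended_Real"
begin

definition hypercube :: "nat \<Rightarrow> (nat \<Rightarrow> nat) set" where
  "hypercube d = {..<d} \<rightarrow>\<^sub>E {0, 1}"

definition hypercube_edges :: "nat \<Rightarrow> ((nat \<Rightarrow> nat) \<times> (nat \<Rightarrow> nat)) set" where
  "hypercube_edges d =
     {(x, y). x \<in> hypercube d \<and> y \<in> hypercube d \<and>
        card {i. i < d \<and> x i \<noteq> y i} = 1 \<and>
        card {i. i < d \<and> y i = 1} = card {i. i < d \<and> x i = 1} + 1}"

definition cube_less :: "nat \<Rightarrow> (nat \<Rightarrow> nat) \<Rightarrow> (nat \<Rightarrow> nat) \<Rightarrow> bool" where
  "cube_less d x y \<longleftrightarrow> x \<noteq> y \<and> (\<forall>i<d. x i \<le> y i)"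

definition matched_pair ::
  "nat \<Rightarrow> (nat \<Rightarrow> nat) set \<Rightarrow> (nat \<Rightarrow> nat) set \<Rightarrow> ((nat \<Rightarrow> nat) \<Rightarrow> (nat \<Rightarrow> nat)) \<Rightarrow> bool" where
  "matched_pair d S' T' \<phi> \<longleftrightarrow>
     S' \<subseteq> hypercube d \<and> T' \<subseteq> hypercube d \<and> bij_betw \<phi> S' T' \<and>
     (\<forall>s\<in>S'. cube_less d s (\<phi> s))"

definition directed_volume :: "nat \<Rightarrow> (nat \<Rightarrow> nat) set \<Rightarrow> nat" where
  "directed_volume d S =
     Max {card S' | S' T'. S' \<subseteq> S \<and> T' \<subseteq> hypercube d - S \<and> (\<exists>\<phi>. matched_pair d S' T' \<phi>)}"

record 'v flow_network =
  nodes :: "'v set"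
  arcs :: "('v \<times> 'v) set"
  capacity :: "'v \<times> 'v \<Rightarrow> ereal"
  source :: 'v
  sink :: 'v

definition outflow :: "'v flow_network \<Rightarrow> ('v \<times> 'v \<Rightarrow> real) \<Rightarrow> 'v \<Rightarrow> real" where
  "outflow N f v = (\<Sum>e | e \<in> arcs N \<and> fst e = v. f e)"

definition inflow :: "'v flow_network \<Rightarrow> ('v \<times> 'v \<Rightarrow> real) \<Rightarrow> 'v \<Rightarrow> real" where
  "inflow N f v = (\<Sum>e | e \<in> arcs N \<and> snd e = v. f e)"

text \<open>A flow is only constrained, and only ever summed, over the arcs of the network.\<close>

definition is_flow :: "'v flow_network \<Rightarrow> ('v \<times> 'v \<Rightarrow> real) \<Rightarrow> bool" where
  "is_flow N f \<longleftrightarrow>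
     (\<forall>e\<in>arcs N. 0 \<le> f e \<and> ereal (f e) \<le> capacity N e) \<and>
     (\<forall>v\<in>nodes N - {source N, sink N}. inflow N f v = outflow N f v)"

definition flow_value :: "'v flow_network \<Rightarrow> ('v \<times> 'v \<Rightarrow> real) \<Rightarrow> real" where
  "flow_value N f = outflow N f (source N) - inflow N f (source N)"

definition is_maximum_flow :: "'v flow_network \<Rightarrow> ('v \<times> 'v \<Rightarrow> real) \<Rightarrow> bool" where
  "is_maximum_flow N f \<longleftrightarrow> is_flow N f \<and> (\<forall>g. is_flow N g \<longrightarrow> flow_value N g \<le> flow_value N f)"

datatype 'v with_supernodes = Source | Sink | Vertex 'v

definition hypercube_network ::
  "nat \<Rightarrow> (nat \<Rightarrow> nat) set \<Rightarrow> (nat \<Rightarrow> nat) with_supernodes flow_network" where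
  "hypercube_network d S =
     \<lparr> nodes = {Source, Sink} \<union> Vertex ` hypercube d,
       arcs = {(Vertex x, Vertex y) | x y. (x, y) \<in> hypercube_edges d}
            \<union> {(Source, Vertex x) | x. x \<in> S}
            \<union> {(Vertex x, Sink) | x. x \<in> hypercube d - S},
       capacity = (\<lambda>(u, v). if u = Source \<or> v = Sink then \<infinity> else 1),
       source = Source,
       sink = Sink \<rparr>"

end

theory Submission
  imports Defs
begin

text \<open>
  The infinite capacities force every finite cut to separate exactly \<open>S\<close> from its complement, and
  sending one unit along each hypercube edge leaving \<open>S\<close> saturates that cut; so the maximum flow is
  the number of edges leaving \<open>S\<close>. It remains to bound the directed volume by this number.

  View \<open>S\<close> as a set family. By induction on the dimension, some up-closed family \<open>U\<close> differs from
  \<open>S\<close> in at most as many points as there are edges leaving \<open>S\<close>. Split along a coordinate into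
  \<open>F\<^sub>0\<close> and \<open>F\<^sub>1\<close>. Since the directed boundary is submodular, either \<open>F\<^sub>0 \<inter> F\<^sub>1\<close> has no
  larger boundary than \<open>F\<^sub>0\<close>, or \<open>F\<^sub>0 \<union> F\<^sub>1\<close> has no larger boundary than \<open>F\<^sub>1\<close>. Replacing
  correspondingly just one of the two halves costs one change per edge leaving \<open>S\<close> in that
  direction, and makes the halves nested; up-closed approximations of nested halves can be made
  nested by taking intersection and union. Finally, every matched pair has an end on which \<open>S\<close> and
  \<open>U\<close> disagree.
\<close>

section \<open>Directed boundaries and up-closed families\<close>

text \<open>The directed edge boundary of \<open>F\<close> in the cube on \<open>Pow I\<close>, each
  edge encoded by its lower end and the added element. Restricting to \<open>A \<subseteq> I\<close>
  here lets the same \<open>F\<close> serve over \<open>insert a I\<close> and, as its lower half,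
  over \<open>I\<close>.\<close>

definition up_boundary :: "'a set \<Rightarrow> 'a set set \<Rightarrow> ('a set \<times> 'a) set" where
  "up_boundary I F = {(A, i). A \<subseteq> I \<and> i \<in> I - A \<and> A \<in> F \<and> insert i A \<notin> F}"

text \<open>The symmetric difference of \<open>F\<close> and \<open>U\<close> within
  \<open>Pow I\<close>.\<close>

definition disagreement :: "'a set \<Rightarrow> 'a set set \<Rightarrow> 'a set set \<Rightarrow> 'a set set" where
  "disagreement I F U = {A. A \<subseteq> I \<and> (A \<in> F) \<noteq> (A \<in> U)}"

definition up_closed :: "'a set \<Rightarrow> 'a set set \<Rightarrow> bool" where
  "up_closed I U \<longleftrightarrow> (\<forall>A B. A \<in> U \<longrightarrow> A \<subseteq> B \<longrightarrow> B \<subseteq> I \<longrightarrow> B \<in> U)"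

lemma finite_up_boundary: "finite I \<Longrightarrow> finite (up_boundary I F)"
  by (rule finite_subset[of _ "Pow I \<times> I"]) (auto simp: up_boundary_def)

lemma finite_disagreement: "finite I \<Longrightarrow> finite (disagreement I F U)"
  by (rule finite_subset[of _ "Pow I"]) (auto simp: disagreement_def)

text \<open>Inclusion-exclusion on both sides. The two inclusions say that every element is counted
  at least as often by \<open>C\<close>, \<open>D\<close> as by \<open>A\<close>,
  \<open>B\<close>.\<close>

lemma card_add_mono_Un_Int:
  assumes "finite C" "finite D" "A \<union> B \<subseteq> C \<union> D" "A \<inter> B \<subseteq> C \<inter> D"
  shows "card A + card B \<le> card C + card D"
proof -
  have "finite A" "finite B"
    using assms by (auto intro: finite_subset[of _ "C \<union> D"])
  then have "card A + card B = card (A \<union> B) + card (A \<inter> B)"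
    by (rule card_Un_Int)
  also have "\<dots> \<le> card (C \<union> D) + card (C \<inter> D)"
    using assms by (intro add_mono card_mono) auto
  also have "\<dots> = card C + card D"
    using assms(1,2) by (rule card_Un_Int[symmetric])
  finally show ?thesis .
qed

text \<open>An edge leaving \<open>F \<inter> G\<close> or \<open>F \<union> G\<close> leaves one of
  \<open>F\<close>, \<open>G\<close>. If it leaves both, its lower end is in both families and its
  upper end in neither, so it leaves both \<open>F\<close> and \<open>G\<close>.\<close>

lemma up_boundary_submodular:
  assumes "finite I"
  shows "card (up_boundary I (F \<inter> G)) + card (up_boundary I (F \<union> G))
    \<le> card (up_boundary I F) + card (up_boundary I G)"
  by (rule card_add_mono_Un_Int) (auto simp: finite_up_boundary assms, auto simp: up_boundary_def)

text \<open>Only points of \<open>U\<^sub>0 - U\<^sub>1\<close> are affected: there the two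
  membership values are swapped into increasing order, the order that
  \<open>H\<^sub>0 \<subseteq> H\<^sub>1\<close> imposes on the target.\<close>

lemma disagreement_Int_Un_le:
  assumes "finite I" "H\<^sub>0 \<subseteq> H\<^sub>1"
  shows "card (disagreement I H\<^sub>0 (U\<^sub>0 \<inter> U\<^sub>1)) + card (disagreement I H\<^sub>1 (U\<^sub>0 \<union> U\<^sub>1))
    \<le> card (disagreement I H\<^sub>0 U\<^sub>0) + card (disagreement I H\<^sub>1 U\<^sub>1)"
  using assms(2)
  by (intro card_add_mono_Un_Int finite_disagreement assms(1)) (auto simp: disagreement_def)

lemma disagreement_triangle:
  assumes "finite I"
  shows "card (disagreement I F U) \<le> card (disagreement I F H) + card (disagreement I H U)"
proof -
  have "card (disagreement I F U) \<le> card (disagreement I F H \<union> disagreement I H U)"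
    by (intro card_mono) (auto simp: finite_disagreement assms, auto simp: disagreement_def)
  also have "\<dots> \<le> card (disagreement I F H) + card (disagreement I H U)"
    by (rule card_Un_le)
  finally show ?thesis .
qed

section \<open>Splitting the cube along one coordinate\<close>

lemma card_disagreement_insert_le:
  assumes "finite I" "a \<notin> I"
  shows "card (disagreement (insert a I) F U)
    \<le> card (disagreement I F U) + card (disagreement I {A. insert a A \<in> F} {A. insert a A \<in> U})"
    (is "_ \<le> _ + card ?D")
proof -
  have "disagreement (insert a I) F U \<subseteq> disagreement I F U \<union> insert a ` ?D"
  proof
    fix A assume A: "A \<in> disagreement (insert a I) F U"
    show "A \<in> disagreement I F U \<union> insert a ` ?D"
    proof (cases "a \<in> A")
      case True
      then have "A = insert a (A - {a})" by auto
      moreover have "A - {a} \<in> ?D"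
        using A True by (auto simp: disagreement_def insert_absorb)
      ultimately show ?thesis by blast
    qed (use A in \<open>auto simp: disagreement_def\<close>)
  qed
  then have "card (disagreement (insert a I) F U) \<le> card (disagreement I F U \<union> insert a ` ?D)"
    by (intro card_mono) (auto simp: finite_disagreement assms)
  also have "\<dots> \<le> card (disagreement I F U) + card (insert a ` ?D)"
    by (rule card_Un_le)
  also have "\<dots> \<le> card (disagreement I F U) + card ?D"
    by (simp add: card_image_le finite_disagreement assms)
  finally show ?thesis .
qed

text \<open>The summands count boundary edges inside the lower half, inside the upper half (shifted
  by \<open>insert a\<close>), and in direction \<open>a\<close>; the three classes are
  disjoint.\<close>

lemma card_up_boundary_insert_ge:
  assumes "finite I" "a \<notin> I"
  shows "card (up_boundary I F) + card (up_boundary I {A. insert a A \<in> F})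
      + card {A. A \<subseteq> I \<and> A \<in> F \<and> insert a A \<notin> F}
    \<le> card (up_boundary (insert a I) F)"
    (is "card ?X + card ?Y + card ?Z \<le> card ?W")
proof -
  let ?g = "\<lambda>(A, i). (insert a A, i)"
  let ?h = "\<lambda>A. (A, a)"
  have inj: "inj_on ?g ?Y"
    using assms(2) by (auto simp: inj_on_def up_boundary_def insert_ident subset_iff)
  have fin: "finite ?X" "finite (?g ` ?Y)" "finite (?h ` ?Z)"
    using assms by (auto simp: finite_up_boundary)
  have "card (?X \<union> ?g ` ?Y \<union> ?h ` ?Z) = card (?X \<union> ?g ` ?Y) + card (?h ` ?Z)"
    using assms(2) fin by (intro card_Un_disjoint) (auto simp: up_boundary_def)
  also have "card (?X \<union> ?g ` ?Y) = card ?X + card (?g ` ?Y)"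
    using assms(2) fin by (intro card_Un_disjoint) (auto simp: up_boundary_def)
  also have "card (?g ` ?Y) = card ?Y"
    using inj by (rule card_image)
  also have "card (?h ` ?Z) = card ?Z"
    by (rule card_image) (auto simp: inj_on_def)
  finally have "card ?X + card ?Y + card ?Z = card (?X \<union> ?g ` ?Y \<union> ?h ` ?Z)" by simp
  also have "\<dots> \<le> card ?W"
    using assms by (intro card_mono finite_up_boundary)
      (auto simp: up_boundary_def insert_commute)
  finally show ?thesis .
qed

theorem up_closed_approximation:
  assumes "finite I"
  shows "\<exists>U. up_closed I U \<and> card (disagreement I F U) \<le> card (up_boundary I F)"
  using assms
proof (induction I arbitrary: F rule: finite_induct)
  case empty
  have "up_closed {} F \<and> card (disagreement {} F F) \<le> card (up_boundary {} F)"
    by (auto simp: up_closed_def disagreement_def)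
  then show ?case by blast
next
  case (insert a I)
  \<comment> \<open>Over \<open>I\<close>, \<open>F\<close> itself is the lower half and
    \<open>F1\<close> the upper one. \<open>Z\<close> holds the lower ends of the edges leaving
    \<open>F\<close> in direction \<open>a\<close>.\<close>
  define F1 where "F1 = {A. insert a A \<in> F}"
  define Z where "Z = {A. A \<subseteq> I \<and> A \<in> F \<and> insert a A \<notin> F}"
  obtain H0 H1 where H: "H0 \<subseteq> H1"
    "card (up_boundary I H0) + card (up_boundary I H1)
      \<le> card (up_boundary I F) + card (up_boundary I F1)"
    "card (disagreement I F H0) + card (disagreement I F1 H1) \<le> card Z"
  proof (cases "card (up_boundary I (F \<inter> F1)) \<le> card (up_boundary I F)")
    case True
    have "disagreement I F (F \<inter> F1) = Z" "disagreement I F1 F1 = {}"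
      by (auto simp: disagreement_def Z_def F1_def)
    then show ?thesis using that[of "F \<inter> F1" F1] True by simp
  next
    \<comment> \<open>The intersection has larger boundary than \<open>F\<close>, so by
      submodularity the union has smaller boundary than \<open>F1\<close>; now only the upper half
      is changed.\<close>
    case False
    have "disagreement I F1 (F \<union> F1) = Z" "disagreement I F F = {}"
      by (auto simp: disagreement_def Z_def F1_def)
    moreover have "card (up_boundary I (F \<union> F1)) \<le> card (up_boundary I F1)"
      using False up_boundary_submodular[OF insert.hyps(1), of F F1] by linarith
    ultimately show ?thesis using that[of F "F \<union> F1"] by simp
  qed
  obtain U0 U1 where U0: "up_closed I U0" "card (disagreement I H0 U0) \<le> card (up_boundary I H0)"
    and U1: "up_closed I U1" "card (disagreement I H1 U1) \<le> card (up_boundary I H1)"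
    using insert.IH by blast
  \<comment> \<open>Lower half \<open>U0 \<inter> U1\<close>, upper half
    \<open>U0 \<union> U1\<close>: since the former is contained in the latter, up-closedness also
    holds across direction \<open>a\<close>.\<close>
  define U where "U = {A. if a \<in> A then A - {a} \<in> U0 \<union> U1 else A \<in> U0 \<inter> U1}"
  have "up_closed (insert a I) U"
    unfolding up_closed_def
  proof (intro allI impI)
    fix A B assume AB: "A \<in> U" "A \<subseteq> B" "B \<subseteq> insert a I"
    have sub: "A - {a} \<subseteq> B - {a}" "B - {a} \<subseteq> I" using AB by auto
    have "B - {a} \<in> U0" if "A - {a} \<in> U0" using U0(1) that sub unfolding up_closed_def by blast
    moreover have "B - {a} \<in> U1" if "A - {a} \<in> U1"
      using U1(1) that sub unfolding up_closed_def by blast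
    ultimately show "B \<in> U" using AB unfolding U_def by (auto split: if_splits)
  qed
  moreover have "card (disagreement (insert a I) F U) \<le> card (up_boundary (insert a I) F)"
  proof -
    have eq0: "disagreement I F U = disagreement I F (U0 \<inter> U1)"
      using insert.hyps(2) by (auto simp: disagreement_def U_def)
    have "A - {a} = A" if "A \<subseteq> I" for A using that insert.hyps(2) by auto
    then have eq1: "disagreement I F1 {A. insert a A \<in> U} = disagreement I F1 (U0 \<union> U1)"
      by (auto simp: disagreement_def U_def)
    \<comment> \<open>Passing through \<open>H0\<close> and \<open>H1\<close> costs at most
      \<open>card Z\<close> in total. Approximating them costs at most their boundaries, hence at
      most those of \<open>F\<close> and \<open>F1\<close>. Together these are bounded by the
      boundary over \<open>insert a I\<close>.\<close>
    note card_disagreement_insert_le[OF insert.hyps(1,2), of F U, folded F1_def]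
      disagreement_triangle[OF insert.hyps(1), of F "U0 \<inter> U1" H0]
      disagreement_triangle[OF insert.hyps(1), of F1 "U0 \<union> U1" H1]
      disagreement_Int_Un_le[OF insert.hyps(1) H(1), of U0 U1]
      card_up_boundary_insert_ge[OF insert.hyps(1,2), of F, folded F1_def Z_def]
    with U0(2) U1(2) H(2,3) show ?thesis unfolding eq0 eq1 by linarith
  qed
  ultimately show ?case by blast
qed


section \<open>Directed volume and edge boundary\<close>

definition cube_boundary :: "nat \<Rightarrow> (nat \<Rightarrow> nat) set \<Rightarrow> ((nat \<Rightarrow> nat) \<times> (nat \<Rightarrow> nat)) set" where
  "cube_boundary d S = {(x, y) \<in> hypercube_edges d. x \<in> S \<and> y \<notin> S}"

section \<open>Vertices of the hypercube as subsets of \<open>{..<d}\<close>\<close>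

definition cube_support :: "nat \<Rightarrow> (nat \<Rightarrow> nat) \<Rightarrow> nat set" where
  "cube_support d x = {i. i < d \<and> x i = 1}"

text \<open>Inverse of \<open>cube_support\<close>; the restricted lambda supplies the value
  \<open>undefined\<close> outside \<open>{..<d}\<close> that membership in
  \<open>hypercube d\<close> demands.\<close>

definition cube_vertex :: "nat \<Rightarrow> nat set \<Rightarrow> nat \<Rightarrow> nat" where
  "cube_vertex d A = (\<lambda>i\<in>{..<d}. if i \<in> A then 1 else 0)"

lemma finite_hypercube: "finite (hypercube d)"
  by (simp add: hypercube_def finite_PiE)

lemma hypercube_edges_subset: "hypercube_edges d \<subseteq> hypercube d \<times> hypercube d"
  by (auto simp: hypercube_edges_def)

lemma finite_hypercube_edges: "finite (hypercube_edges d)"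
  by (rule finite_subset[OF hypercube_edges_subset]) (simp add: finite_hypercube)

lemma finite_cube_boundary: "finite (cube_boundary d S)"
  by (rule finite_subset[OF _ finite_hypercube_edges[of d]]) (auto simp: cube_boundary_def)

lemma cube_vertex_in_hypercube: "cube_vertex d A \<in> hypercube d"
  by (auto simp: cube_vertex_def hypercube_def)

lemma cube_support_vertex: "A \<subseteq> {..<d} \<Longrightarrow> cube_support d (cube_vertex d A) = A"
  by (auto simp: cube_support_def cube_vertex_def)

lemma cube_vertex_support:
  assumes "x \<in> hypercube d" shows "cube_vertex d (cube_support d x) = x"
proof
  fix i show "cube_vertex d (cube_support d x) i = x i"
    using assms by (cases "i < d")
      (auto simp: cube_support_def cube_vertex_def hypercube_def PiE_iff extensional_def)
qed

lemma inj_on_cube_support: "inj_on (cube_support d) (hypercube d)"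
  by (rule inj_on_inverseI[of _ "cube_vertex d"]) (rule cube_vertex_support)

lemma cube_support_mono:
  assumes "x \<in> hypercube d" "y \<in> hypercube d" "cube_less d x y"
  shows "cube_support d x \<subseteq> cube_support d y"
proof
  fix i assume "i \<in> cube_support d x"
  then have "i < d" "1 \<le> y i" using assms(3) by (auto simp: cube_support_def cube_less_def)
  moreover from this have "y i \<in> {0, 1}"
    using assms(2) by (auto simp: hypercube_def dest!: PiE_mem[where x = i])
  ultimately show "i \<in> cube_support d y" by (auto simp: cube_support_def)
qed

lemma cube_vertex_insert_edge:
  assumes "A \<subseteq> {..<d}" "i < d" "i \<notin> A"
  shows "(cube_vertex d A, cube_vertex d (insert i A)) \<in> hypercube_edges d"
proof -
  have diff: "{j. j < d \<and> cube_vertex d A j \<noteq> cube_vertex d (insert i A) j} = {i}"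
    using assms by (auto simp: cube_vertex_def)
  have "finite A" using assms(1) by (rule finite_subset) simp
  moreover have "insert i A \<subseteq> {..<d}" using assms by auto
  ultimately have "card (cube_support d (cube_vertex d (insert i A)))
      = card (cube_support d (cube_vertex d A)) + 1"
    using assms by (simp add: cube_support_vertex)
  then show ?thesis
    unfolding hypercube_edges_def using diff
    by (simp add: cube_vertex_in_hypercube cube_support_def)
qed

text \<open>Sending \<open>(A, i)\<close> to the edge from \<open>A\<close> to
  \<open>insert i A\<close> is injective, because \<open>i \<notin> A\<close> makes \<open>i\<close>
  recoverable from the two ends.\<close>

lemma card_up_boundary_le_cube_boundary:
  assumes "S \<subseteq> hypercube d"
  shows "card (up_boundary {..<d} (cube_support d ` S)) \<le> card (cube_boundary d S)"
proof (rule card_inj_on_le[OF _ _ finite_cube_boundary])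
  let ?g = "\<lambda>(A, i). (cube_vertex d A, cube_vertex d (insert i A))"
  have mem: "A \<in> cube_support d ` S \<longleftrightarrow> cube_vertex d A \<in> S" if "A \<subseteq> {..<d}" for A
  proof
    assume "A \<in> cube_support d ` S"
    then obtain x where "x \<in> S" "A = cube_support d x" by auto
    then show "cube_vertex d A \<in> S" using assms by (auto simp: cube_vertex_support)
  next
    assume "cube_vertex d A \<in> S"
    then show "A \<in> cube_support d ` S" using cube_support_vertex[OF that] by (metis imageI)
  qed
  show "?g ` up_boundary {..<d} (cube_support d ` S) \<subseteq> cube_boundary d S"
  proof clarify
    fix A i assume "(A, i) \<in> up_boundary {..<d} (cube_support d ` S)"
    then have "A \<subseteq> {..<d}" "i < d" "i \<notin> A" "cube_vertex d A \<in> S" "cube_vertex d (insert i A) \<notin> S"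
      using mem[of A] mem[of "insert i A"] unfolding up_boundary_def by blast+
    then show "(cube_vertex d A, cube_vertex d (insert i A)) \<in> cube_boundary d S"
      by (simp add: cube_boundary_def cube_vertex_insert_edge)
  qed
  show "inj_on ?g (up_boundary {..<d} (cube_support d ` S))"
  proof (rule inj_onI, clarify)
    fix A i B j
    assume *: "(A, i) \<in> up_boundary {..<d} (cube_support d ` S)"
      "(B, j) \<in> up_boundary {..<d} (cube_support d ` S)"
      "cube_vertex d A = cube_vertex d B"
      "cube_vertex d (insert i A) = cube_vertex d (insert j B)"
    then have sub: "A \<subseteq> {..<d}" "B \<subseteq> {..<d}" "insert i A \<subseteq> {..<d}" "insert j B \<subseteq> {..<d}"
      and notin: "i \<notin> A" "j \<notin> B"
      by (auto simp: up_boundary_def)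
    have "A = B" "insert i A = insert j B"
      using *(3,4) sub by (metis cube_support_vertex)+
    then show "A = B \<and> i = j" using notin by auto
  qed
qed

section \<open>Matched pairs against an up-closed approximation\<close>

lemma matched_pair_card_le_cube_boundary:
  assumes "S \<subseteq> hypercube d" "S' \<subseteq> S" "T' \<subseteq> hypercube d - S" "matched_pair d S' T' \<phi>"
  shows "card S' \<le> card (cube_boundary d S)"
proof -
  let ?F = "cube_support d ` S"
  obtain U where U: "up_closed {..<d} U"
    "card (disagreement {..<d} ?F U) \<le> card (up_boundary {..<d} ?F)"
    using up_closed_approximation[of "{..<d}" ?F] by auto
  have mem: "cube_support d x \<in> ?F \<longleftrightarrow> x \<in> S" if "x \<in> hypercube d" for x
    using inj_on_image_mem_iff[OF inj_on_cube_support that assms(1)] .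
  have sub: "cube_support d x \<subseteq> {..<d}" for x by (auto simp: cube_support_def)
  have inj: "inj_on \<phi> S'" and img: "\<phi> ` S' = T'" and less: "\<forall>s\<in>S'. cube_less d s (\<phi> s)"
    using assms(4) by (auto simp: matched_pair_def bij_betw_def)
  \<comment> \<open>The end on which \<open>S\<close> and \<open>U\<close> disagree: if
    \<open>s\<close> is in \<open>U\<close>, so is \<open>\<phi> s\<close> by up-closedness, yet
    \<open>\<phi> s \<notin> S\<close>; otherwise \<open>s\<close> itself is in \<open>S\<close> but
    not in \<open>U\<close>.\<close>
  let ?end = "\<lambda>s. if cube_support d s \<in> U then \<phi> s else s"
  have "card S' \<le> card (disagreement {..<d} ?F U)"
  proof (rule card_inj_on_le[OF _ _ finite_disagreement[OF finite_lessThan]])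
    \<comment> \<open>Two lower ends or two upper ends differ by injectivity; a lower and an upper
      end differ because one lies in \<open>S\<close> and the other outside.\<close>
    have "inj_on ?end S'"
      using inj img assms(2,3) by (auto simp: inj_on_def)
    moreover have "?end ` S' \<subseteq> hypercube d" using img assms(1,2,3) by auto
    ultimately show "inj_on (cube_support d \<circ> ?end) S'"
      by (intro comp_inj_on inj_on_subset[OF inj_on_cube_support])
    show "(cube_support d \<circ> ?end) ` S' \<subseteq> disagreement {..<d} ?F U"
    proof clarify
      fix s assume s: "s \<in> S'"
      then have cube: "s \<in> S" "s \<in> hypercube d" "\<phi> s \<in> hypercube d" "\<phi> s \<notin> S"
        using img assms(1,2,3) by auto
      have "cube_support d (\<phi> s) \<in> U" if "cube_support d s \<in> U"
        using U(1) that cube_support_mono[OF cube(2,3)] less s sub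
        unfolding up_closed_def by blast
      then show "(cube_support d \<circ> ?end) s \<in> disagreement {..<d} ?F U"
        using cube sub by (auto simp: disagreement_def mem)
    qed
  qed
  with U(2) card_up_boundary_le_cube_boundary[OF assms(1)] show ?thesis by linarith
qed

lemma directed_volume_le_cube_boundary:
  assumes "S \<subseteq> hypercube d"
  shows "directed_volume d S \<le> card (cube_boundary d S)"
proof -
  let ?M = "{card S' | S' T'. S' \<subseteq> S \<and> T' \<subseteq> hypercube d - S \<and> (\<exists>\<phi>. matched_pair d S' T' \<phi>)}"
  have bound: "\<forall>n\<in>?M. n \<le> card (cube_boundary d S)"
    using matched_pair_card_le_cube_boundary[OF assms] by blast
  then have "finite ?M" by (meson finite_nat_set_iff_bounded_le)
  \<comment> \<open>The empty pair makes the set under \<open>Max\<close> nonempty.\<close>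
  moreover have "matched_pair d {} {} id" by (simp add: matched_pair_def)
  then have "?M \<noteq> {}" by blast
  ultimately show ?thesis unfolding directed_volume_def using bound by (intro Max.boundedI) blast+
qed


section \<open>The maximum flow\<close>

text \<open>Sum the net outflow over \<open>A\<close>: conservation leaves only the source term,
  while grouping arcs by tail and by head makes those inside \<open>A\<close> cancel.\<close>

lemma flow_value_eq_cut:
  assumes "finite (arcs N)" "finite A" "is_flow N f"
    and "A \<subseteq> nodes N - {sink N}" "source N \<in> A"
  shows "flow_value N f = (\<Sum>e | e \<in> arcs N \<and> fst e \<in> A \<and> snd e \<notin> A. f e)
    - (\<Sum>e | e \<in> arcs N \<and> fst e \<notin> A \<and> snd e \<in> A. f e)"
proof -
  have out: "(\<Sum>v\<in>A. outflow N f v) = (\<Sum>e | e \<in> arcs N \<and> fst e \<in> A. f e)"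
    unfolding outflow_def
    using assms(1,2)
    by (subst sum.group[of "{e \<in> arcs N. fst e \<in> A}" A fst f, symmetric])
      (auto intro!: sum.cong)
  have inn: "(\<Sum>v\<in>A. inflow N f v) = (\<Sum>e | e \<in> arcs N \<and> snd e \<in> A. f e)"
    unfolding inflow_def
    using assms(1,2)
    by (subst sum.group[of "{e \<in> arcs N. snd e \<in> A}" A snd f, symmetric])
      (auto intro!: sum.cong)
  let ?both = "\<Sum>e | e \<in> arcs N \<and> fst e \<in> A \<and> snd e \<in> A. f e"
  have "flow_value N f = (\<Sum>v\<in>A. outflow N f v - inflow N f v)"
  proof -
    have "(\<Sum>v\<in>A - {source N}. outflow N f v - inflow N f v) = 0"
    proof (intro sum.neutral ballI)
      fix v assume "v \<in> A - {source N}"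
      then have "v \<in> nodes N - {source N, sink N}" using assms(4) by auto
      then show "outflow N f v - inflow N f v = 0" using assms(3) by (simp add: is_flow_def)
    qed
    then show ?thesis
      using assms(2,5) by (simp add: flow_value_def sum.remove)
  qed
  also have "\<dots> = (\<Sum>e | e \<in> arcs N \<and> fst e \<in> A. f e) - (\<Sum>e | e \<in> arcs N \<and> snd e \<in> A. f e)"
    by (simp add: sum_subtractf out inn)
  also have "(\<Sum>e | e \<in> arcs N \<and> fst e \<in> A. f e)
      = ?both + (\<Sum>e | e \<in> arcs N \<and> fst e \<in> A \<and> snd e \<notin> A. f e)"
    using assms(1) by (subst sum.union_disjoint[symmetric]) (auto intro!: sum.cong)
  also have "(\<Sum>e | e \<in> arcs N \<and> snd e \<in> A. f e)
      = ?both + (\<Sum>e | e \<in> arcs N \<and> fst e \<notin> A \<and> snd e \<in> A. f e)"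
    using assms(1) by (subst sum.union_disjoint[symmetric]) (auto intro!: sum.cong)
  finally show ?thesis by simp
qed

text \<open>One unit on every edge of \<open>B\<close>; the supernode arcs carry the number of
  \<open>B\<close>-edges at their vertex, as conservation requires. The default 0 falls only on
  pairs that are not arcs of the hypercube network.\<close>

fun boundary_flow ::
  "((nat \<Rightarrow> nat) \<times> (nat \<Rightarrow> nat)) set
    \<Rightarrow> (nat \<Rightarrow> nat) with_supernodes \<times> (nat \<Rightarrow> nat) with_supernodes \<Rightarrow> real" where
  "boundary_flow B (Source, Vertex x) = card {y. (x, y) \<in> B}"
| "boundary_flow B (Vertex x, Sink) = card {y. (y, x) \<in> B}"
| "boundary_flow B (Vertex x, Vertex y) = of_bool ((x, y) \<in> B)"
| "boundary_flow B _ = 0"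

lemma arcs_hypercube_network:
  "arcs (hypercube_network d S) = {(Vertex x, Vertex y) | x y. (x, y) \<in> hypercube_edges d}
     \<union> {(Source, Vertex x) | x. x \<in> S} \<union> {(Vertex x, Sink) | x. x \<in> hypercube d - S}"
  by (simp add: hypercube_network_def)

lemma finite_arcs_hypercube_network:
  assumes "S \<subseteq> hypercube d" shows "finite (arcs (hypercube_network d S))"
proof (rule finite_subset)
  let ?V = "{Source, Sink} \<union> Vertex ` hypercube d"
  show "arcs (hypercube_network d S) \<subseteq> ?V \<times> ?V"
    using assms hypercube_edges_subset by (auto simp: arcs_hypercube_network)
  show "finite (?V \<times> ?V)" by (simp add: finite_hypercube)
qed

lemma boundary_flow_nonneg: "0 \<le> boundary_flow B e"
  by (induction B e rule: boundary_flow.induct) auto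

lemma sum_over_image_eq_card:
  fixes f :: "'b \<Rightarrow> real"
  assumes "finite X" "inj_on g Y" "g ` Y \<subseteq> X" "\<And>y. y \<in> Y \<Longrightarrow> f (g y) = 1"
    and "\<And>e. e \<in> X - g ` Y \<Longrightarrow> f e = 0"
  shows "sum f X = card Y"
proof -
  have "sum f X = sum f (g ` Y)"
    using assms by (intro sum.mono_neutral_right) auto
  also have "\<dots> = card Y" using assms by (simp add: sum.reindex)
  finally show ?thesis .
qed

lemma is_flow_boundary_flow:
  assumes "S \<subseteq> hypercube d"
  shows "is_flow (hypercube_network d S) (boundary_flow (cube_boundary d S))"
    (is "is_flow ?N ?f")
proof -
  let ?B = "cube_boundary d S"
  have fin: "finite (arcs ?N)" using assms by (rule finite_arcs_hypercube_network)
  have "ereal (?f e) \<le> capacity ?N e" if "e \<in> arcs ?N" for e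
    using that by (auto simp: arcs_hypercube_network) (auto simp: hypercube_network_def)
  moreover have "inflow ?N ?f (Vertex x) = outflow ?N ?f (Vertex x)" if x: "x \<in> hypercube d" for x
  proof (cases "x \<in> S")
    case True
    \<comment> \<open>Boundary edges end outside \<open>S\<close>, so only the arc from
      \<open>Source\<close> can bring flow into \<open>x\<close>. The other case is dual, with
      \<open>Sink\<close>.\<close>
    have "inflow ?N ?f (Vertex x) = sum ?f {(Source, Vertex x)}"
      unfolding inflow_def using fin True
      by (intro sum.mono_neutral_right) (auto simp: arcs_hypercube_network cube_boundary_def)
    moreover have "outflow ?N ?f (Vertex x) = card {y. (x, y) \<in> ?B}"
      unfolding outflow_def using fin True
      by (intro sum_over_image_eq_card[where g = "\<lambda>y. (Vertex x, Vertex y)"])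
        (auto simp: arcs_hypercube_network cube_boundary_def inj_on_def)
    ultimately show ?thesis by simp
  next
    case False
    have "outflow ?N ?f (Vertex x) = sum ?f {(Vertex x, Sink)}"
      unfolding outflow_def using fin False x
      by (intro sum.mono_neutral_right) (auto simp: arcs_hypercube_network cube_boundary_def)
    moreover have "inflow ?N ?f (Vertex x) = card {y. (y, x) \<in> ?B}"
      unfolding inflow_def using fin False
      by (intro sum_over_image_eq_card[where g = "\<lambda>y. (Vertex y, Vertex x)"])
        (auto simp: arcs_hypercube_network cube_boundary_def inj_on_def)
    ultimately show ?thesis by simp
  qed
  ultimately show ?thesis
    unfolding is_flow_def by (auto simp: boundary_flow_nonneg) (auto simp: hypercube_network_def)
qed

text \<open>Apply the cut formula to \<open>Source\<close> together with \<open>S\<close>. Arcs from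
  \<open>Source\<close> stay inside this set and arcs into \<open>Sink\<close> stay outside, so only
  hypercube edges cross.\<close>

lemma flow_value_hypercube_network:
  assumes "S \<subseteq> hypercube d" "is_flow (hypercube_network d S) f"
  shows "flow_value (hypercube_network d S) f
    = (\<Sum>(x, y)\<in>cube_boundary d S. f (Vertex x, Vertex y))
      - (\<Sum>(x, y) | (x, y) \<in> hypercube_edges d \<and> x \<notin> S \<and> y \<in> S. f (Vertex x, Vertex y))"
proof -
  let ?N = "hypercube_network d S"
  let ?A = "insert Source (Vertex ` S)"
  let ?R = "{(x, y). (x, y) \<in> hypercube_edges d \<and> x \<notin> S \<and> y \<in> S}"
  have "finite S" using assms(1) finite_hypercube by (rule finite_subset)
  then have "flow_value ?N f = (\<Sum>e | e \<in> arcs ?N \<and> fst e \<in> ?A \<and> snd e \<notin> ?A. f e)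
      - (\<Sum>e | e \<in> arcs ?N \<and> fst e \<notin> ?A \<and> snd e \<in> ?A. f e)"
    using assms by (intro flow_value_eq_cut finite_arcs_hypercube_network)
      (auto simp: hypercube_network_def)
  also have "{e. e \<in> arcs ?N \<and> fst e \<in> ?A \<and> snd e \<notin> ?A} = map_prod Vertex Vertex ` cube_boundary d S"
    by (auto simp: arcs_hypercube_network cube_boundary_def image_iff)
  also have "{e. e \<in> arcs ?N \<and> fst e \<notin> ?A \<and> snd e \<in> ?A} = map_prod Vertex Vertex ` ?R"
    by (auto simp: arcs_hypercube_network image_iff)
  also have "sum f (map_prod Vertex Vertex ` cube_boundary d S)
      = (\<Sum>(x, y)\<in>cube_boundary d S. f (Vertex x, Vertex y))"
    by (subst sum.reindex) (auto simp: inj_on_def intro!: sum.cong)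
  also have "sum f (map_prod Vertex Vertex ` ?R) = (\<Sum>(x, y)\<in>?R. f (Vertex x, Vertex y))"
    by (subst sum.reindex) (auto simp: inj_on_def intro!: sum.cong)
  finally show ?thesis .
qed

lemma flow_value_boundary_flow:
  assumes "S \<subseteq> hypercube d"
  shows "flow_value (hypercube_network d S) (boundary_flow (cube_boundary d S))
    = card (cube_boundary d S)"
proof -
  let ?B = "cube_boundary d S"
  have "(\<Sum>(x, y)\<in>?B. boundary_flow ?B (Vertex x, Vertex y)) = (\<Sum>_\<in>?B. 1)"
    by (intro sum.cong) auto
  moreover have "(\<Sum>(x, y) | (x, y) \<in> hypercube_edges d \<and> x \<notin> S \<and> y \<in> S.
      boundary_flow ?B (Vertex x, Vertex y)) = 0"
    by (intro sum.neutral) (auto simp: cube_boundary_def)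
  ultimately show ?thesis
    using flow_value_hypercube_network[OF assms is_flow_boundary_flow[OF assms]] by simp
qed

text \<open>Weak duality for this cut: each edge leaving \<open>S\<close> carries at most 1, and the
  edges entering \<open>S\<close> only subtract.\<close>

lemma flow_value_le_card_boundary:
  assumes "S \<subseteq> hypercube d" "is_flow (hypercube_network d S) f"
  shows "flow_value (hypercube_network d S) f \<le> card (cube_boundary d S)"
proof -
  have edge: "0 \<le> f (Vertex x, Vertex y) \<and> f (Vertex x, Vertex y) \<le> 1"
    if "(x, y) \<in> hypercube_edges d" for x y
  proof -
    let ?e = "(Vertex x, Vertex y)"
    have "?e \<in> arcs (hypercube_network d S)" using that by (simp add: arcs_hypercube_network)
    then have "0 \<le> f ?e \<and> ereal (f ?e) \<le> capacity (hypercube_network d S) ?e"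
      using assms(2) by (simp only: is_flow_def)
    then show ?thesis by (simp add: hypercube_network_def)
  qed
  have "(\<Sum>(x, y)\<in>cube_boundary d S. f (Vertex x, Vertex y)) \<le> (\<Sum>_\<in>cube_boundary d S. 1)"
    using edge by (intro sum_mono) (auto simp: cube_boundary_def)
  moreover have "0 \<le> (\<Sum>(x, y) | (x, y) \<in> hypercube_edges d \<and> x \<notin> S \<and> y \<in> S.
      f (Vertex x, Vertex y))"
    using edge by (intro sum_nonneg) auto
  ultimately show ?thesis using flow_value_hypercube_network[OF assms] by simp
qed

theorem theorem4p6:
  fixes d :: nat and S :: "(nat \<Rightarrow> nat) set"
  assumes "d \<ge> 1" and "S \<subseteq> hypercube d"
  shows "\<exists>f. is_maximum_flow (hypercube_network d S) f \<and>
             real (directed_volume d S) \<le> flow_value (hypercube_network d S) f"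
proof (intro exI conjI)
  \<comment> \<open>This flow attains the cut bound \<open>card (cube_boundary d S)\<close>, which
    is therefore the maximum flow value.\<close>
  let ?f = "boundary_flow (cube_boundary d S)"
  show "is_maximum_flow (hypercube_network d S) ?f"
    unfolding is_maximum_flow_def
    using is_flow_boundary_flow[OF assms(2)] flow_value_boundary_flow[OF assms(2)]
      flow_value_le_card_boundary[OF assms(2)] by simp
  show "real (directed_volume d S) \<le> flow_value (hypercube_network d S) ?f"
    using directed_volume_le_cube_boundary[OF assms(2)] flow_value_boundary_flow[OF assms(2)]
    by simp
qed

end
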